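(* Let $\alpha>1$ be a real number. Then there exist an uncountable set $C$ of irrational numbers in $(0,1)$ and a set $\Xi_\alpha\subset(0,\infty)$ of cardinality $2^{\aleph_0}$ such that \[ C\ \subseteq\ \operatorname{sp}\bigl((\xi\alpha^n)_{n\ge1}\bigr)\qquad\text{for every }\xi\in\Xi_\alpha . \] In particular, the spectrum $\operatorname{sp}\bigl((\xi\alpha^n)_{n\ge1}\bigr)$ is uncountable for every $\xi\in\Xi_\alpha$, and so the assertion "for every non-zero real number $\xi$ and every real number $\alpha>1$, the spectrum of the sequence $(\xi\alpha^n)_{n\ge1}$ is at most countable" is false.
   Context: For a real number $t$, $\{t\}$ denotes its fractional part. A sequence $(x_n)_{n\ge1}$ of real numbers is uniformly distributed modulo one (u.d. mod 1) if \[ \frac1N\,\#\bigl\{1\le n\le N:\{x_n\}\in[a,b)\bigr\}\longrightarrow b-a\qquad(N\to\infty) \] for all $0\le a<b\le1$. The spectrum of a sequence $(x_n)_{n\ge1}$ of real numbers is \[ \operatorname{sp}\bigl((x_n)_{n\ge1}\bigr)=\bigl\{\theta\in(0,1)\setminus\mathbb{Q}:\ (x_n-n\theta)_{n\ge1}\ \text{is not u.d. mod }1\bigr\}. \] *)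

theory Defs
  imports Complex_Main "HOL-Library.Equipollence" "HOL-Library.Countable_Set"
begin

text \<open>A sequence \<open>(x\<^sub>n)\<close> with \<open>n \<ge> 1\<close> is encoded as a function on \<^typ>\<open>nat\<close> whose value
  at \<open>0\<close> is never used.\<close>

definition ud_mod1 :: "(nat \<Rightarrow> real) \<Rightarrow> bool" where
  "ud_mod1 x \<longleftrightarrow>
     (\<forall>a b. 0 \<le> a \<and> a < b \<and> b \<le> 1 \<longrightarrow>
        (\<lambda>N. 1 / real N * real (card {n \<in> {1..N}. frac (x n) \<in> {a..<b}}))
          \<longlonglongrightarrow> b - a)"

definition spectrum :: "(nat \<Rightarrow> real) \<Rightarrow> real set" where
  "spectrum x = {\<theta> \<in> {0<..<1} - \<rat>. \<not> ud_mod1 (\<lambda>n. x n - real n * \<theta>)}"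

end

theory Submission
  imports Defs "HOL-Analysis.Elementary_Normed_Spaces"
begin

text \<open>Choose \<open>m\<close> with \<open>L = \<alpha>\<^sup>m > 5 m + 1\<close>. For arbitrary targets \<open>T\<^sub>j\<close> there is a \<open>\<xi>\<close> such that
  \<open>\<xi> L\<^sup>j\<close> lies within \<open>1 / (2 (L - 1))\<close> of \<open>T\<^sub>j\<close> modulo one for every \<open>j\<close>. Enumerate the rationals
  as \<open>q\<^sub>i\<close>, each occurring infinitely often, and take \<open>T\<^sub>j \<approx> m j q\<^sub>i\<close> for \<open>i! < j \<le> (i+1)!\<close>. If
  \<open>\<theta>\<close> is extremely close to \<open>q\<^sub>i\<close> for infinitely many \<open>i\<close>, then up to \<open>N = m (i+1)!\<close> nearly all
  multiples \<open>n\<close> of \<open>m\<close>, a proportion of about \<open>1/m\<close>, put \<open>\<xi> \<alpha>\<^sup>n - n \<theta>\<close> into an arc of length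
  \<open>5 / (L - 1) < 1/m\<close>. Such \<open>\<theta>\<close> form a dense \<open>G\<^sub>\<delta>\<close> set, uncountable by Baire, which does not
  depend on \<open>\<xi>\<close>; and there is room to encode one free bit in each \<open>T\<^sub>j\<close>.\<close>

text \<open>Pick \<open>u j\<close> congruent to \<open>T j\<close> mod 1 and within 1/2 of
  \<open>L * u (j - 1)\<close> for j > 0. The intervals \<open>[lo j, hi j]\<close>, of radius
  \<open>h / L ^ j\<close> about \<open>u j / L ^ j\<close>, are then nested, and any common point
  serves as \<open>\<xi>\<close>.\<close>

lemma exists_geometric_orbit_near_targets:
  fixes L :: real and T :: "nat \<Rightarrow> real"
  assumes L: "L > 1"
  shows "\<exists>\<xi>>0. \<forall>j. \<exists>k::int. \<bar>\<xi> * L ^ j - T j - of_int k\<bar> \<le> 1 / (2 * (L - 1))"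
proof -
  \<comment> \<open>This \<open>h\<close> solves \<open>h * L = h + 1/2\<close>: scaling by
    \<open>L\<close> leaves exactly enough room to absorb a rounding error of 1/2.\<close>
  define h where "h = 1 / (2 * (L - 1))"
  have h0: "h > 0" and hL: "h * L = h + 1/2"
    using L by (auto simp: h_def field_simps)
  \<comment> \<open>The integer shift in the initial value only serves to make
    \<open>u 0 \<ge> h + 1\<close>, which forces \<open>\<xi> > 0\<close>.\<close>
  define u where "u = rec_nat (T 0 + of_int \<lceil>h + 1 - T 0\<rceil>)
    (\<lambda>j x. T (Suc j) + of_int (round (L * x - T (Suc j))))"
  have u0: "u 0 = T 0 + of_int \<lceil>h + 1 - T 0\<rceil>"
    and uS: "u (Suc j) = T (Suc j) + of_int (round (L * u j - T (Suc j)))" for j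
    by (simp_all add: u_def)
  have int: "\<exists>k::int. u j - T j = of_int k" for j
    by (cases j) (auto simp: u0 uS)
  have step: "\<bar>u (Suc j) - L * u j\<bar> \<le> 1/2" for j
    using of_int_round_abs_le[of "L * u j - T (Suc j)"] unfolding uS by argo
  define lo hi where "lo = (\<lambda>j. (u j - h) / L ^ j)" and "hi = (\<lambda>j. (u j + h) / L ^ j)"
  have Lj: "L ^ j > 0" for j using L by simp
  have "lo j \<le> lo (Suc j)" for j
  proof -
    have "L * (u j - h) \<le> u (Suc j) - h"
      using step[of j] hL unfolding abs_le_iff by (simp add: right_diff_distrib mult.commute[of L h])
    moreover have "lo j = L * (u j - h) / L ^ Suc j" using L by (simp add: lo_def)
    ultimately show ?thesis unfolding lo_def using Lj[of "Suc j"] by (simp only: divide_right_mono less_imp_le)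
  qed
  then have lo: "incseq lo" by (rule incseq_SucI)
  have "hi (Suc j) \<le> hi j" for j
  proof -
    have "u (Suc j) + h \<le> L * (u j + h)"
      using step[of j] hL unfolding abs_le_iff by (simp add: distrib_left mult.commute[of L h])
    moreover have "hi j = L * (u j + h) / L ^ Suc j" using L by (simp add: hi_def)
    ultimately show ?thesis unfolding hi_def using Lj[of "Suc j"] by (simp only: divide_right_mono less_imp_le)
  qed
  then have hi: "decseq hi" by (rule decseq_SucI)
  have lohi: "lo i \<le> hi j" for i j
  proof -
    have "lo i \<le> lo (max i j)" using lo by (simp add: incseqD)
    also have "\<dots> \<le> hi (max i j)"
      using h0 Lj[of "max i j"] by (simp add: lo_def hi_def divide_right_mono)
    also have "\<dots> \<le> hi j" using hi by (simp add: decseqD)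
    finally show ?thesis .
  qed
  define \<xi> where "\<xi> = (SUP i. lo i)"
  have bdd: "bdd_above (range lo)" using lohi by (auto intro!: bdd_aboveI[of _ "hi 0"])
  have ge: "lo j \<le> \<xi>" for j unfolding \<xi>_def using bdd by (simp add: cSUP_upper)
  have le: "\<xi> \<le> hi j" for j unfolding \<xi>_def using lohi by (intro cSUP_least) auto
  have near: "\<bar>\<xi> * L ^ j - u j\<bar> \<le> h" for j
    using ge[of j] le[of j] Lj[of j] by (simp add: lo_def hi_def field_simps abs_le_iff)
  have "u 0 \<ge> h + 1" unfolding u0 using le_of_int_ceiling[of "h + 1 - T 0"] by linarith
  then have "\<xi> > 0" using near[of 0] by simp
  moreover have "\<exists>k::int. \<bar>\<xi> * L ^ j - T j - of_int k\<bar> \<le> h" for j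
  proof -
    obtain k :: int where "u j - T j = of_int k" using int by blast
    then have "\<bar>\<xi> * L ^ j - T j - of_int k\<bar> \<le> h" using near[of j] by argo
    then show ?thesis by blast
  qed
  ultimately show ?thesis unfolding h_def by blast
qed

lemma uncountable_irrational_limsup_balls:
  fixes q \<rho> :: "nat \<Rightarrow> real"
  assumes pos: "\<And>i. \<rho> i > 0" and dense: "\<And>J. closure (q ` {J..}) = UNIV"
  shows "uncountable {x \<in> {0<..<1} - \<rat>. \<exists>\<^sub>F i in sequentially. \<bar>x - q i\<bar> < \<rho> i}"
    (is "uncountable ?A")
proof
  assume A: "countable ?A"
  define U where "U = (\<lambda>J. \<Union>i\<in>{J..}. ball (q i) (\<rho> i))"
  \<comment> \<open>Were \<open>?A\<close> countable, its points and the rationals could be deleted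
    one at a time as further dense open conditions; Baire then yields a point of \<open>?A\<close>
    outside \<open>?A\<close>.\<close>
  define G where "G = range U \<union> (\<lambda>x. - {x}) ` (?A \<union> \<rat>)"
  have "countable G" unfolding G_def using A countable_rat by blast
  moreover have "open S \<and> closure S = UNIV" if "S \<in> G" for S
  proof -
    have "q ` {J..} \<subseteq> U J" for J using pos by (force simp: U_def)
    then have "closure (U J) = UNIV" for J
      using dense[of J] closure_mono by blast
    moreover have "open (U J)" for J by (auto simp: U_def)
    moreover have "closure (- {x}) = UNIV" for x :: real
      by (simp add: closure_complement)
    ultimately show ?thesis using that unfolding G_def by blast
  qed
  ultimately have "UNIV \<subseteq> closure (\<Inter>G)"
    by (intro Baire) auto
  then have "1/2 \<in> {0<..<1} \<inter> closure (\<Inter>G)" by auto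
  then have "{0<..<1} \<inter> closure (\<Inter>G) \<noteq> {}" by blast
  then have "{0<..<1} \<inter> \<Inter>G \<noteq> {}"
    by (subst (asm) open_Int_closure_eq_empty) auto
  then obtain x where x: "x \<in> {0<..<1}" "x \<in> \<Inter>G" by blast
  have xU: "x \<in> U J" for J using x by (auto simp: G_def)
  have "x \<notin> ?A \<union> \<rat>" using x(2) unfolding G_def by blast
  moreover have "\<exists>\<^sub>F i in sequentially. \<bar>x - q i\<bar> < \<rho> i"
    unfolding frequently_sequentially using xU
    by (force simp: U_def dist_real_def abs_minus_commute)
  ultimately show False using x(1) by blast
qed

lemma exists_rational_sequence_dense_tails:
  "\<exists>q :: nat \<Rightarrow> real. \<forall>J. closure (q ` {J..}) = UNIV"
proof -
  \<comment> \<open>Discarding the second component of the pair makes every rational recur at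
    arbitrarily large indices, so each tail still covers all of them.\<close>
  define q :: "nat \<Rightarrow> real" where "q = (\<lambda>i. of_rat (from_nat (fst (prod_decode i))))"
  have "\<rat> \<subseteq> q ` {J..}" for J
  proof
    fix x :: real assume "x \<in> \<rat>"
    then obtain r where r: "x = of_rat r" by (rule Rats_cases)
    have "q (prod_encode (to_nat r, J)) = x" by (simp add: q_def r)
    then show "x \<in> q ` {J..}" using le_prod_encode_2[of J "to_nat r"] by (metis atLeast_iff image_eqI)
  qed
  then have "closure (\<rat> :: real set) \<subseteq> closure (q ` {J..})" for J by (rule closure_mono)
  moreover have "closure (\<rat> :: real set) = UNIV"
  proof (intro set_eqI iffI UNIV_I)
    fix x :: real
    have "\<exists>y\<in>\<rat>. dist y x < e" if "e > 0" for e
      using Rats_dense_in_real[of x "x + e"] that by (force simp: dist_real_def)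
    then show "x \<in> closure \<rat>" by (simp add: closure_approachable)
  qed
  ultimately show ?thesis by auto
qed

text \<open>Among the first \<open>N = m * fact (Suc i)\<close> indices, the good ones
  \<open>m * j\<close> have proportion \<open>(1 - 1 / (i + 1)) / m\<close>, because
  \<open>fact i\<close> is negligible against \<open>fact (Suc i)\<close>. This tends to
  \<open>1 / m > b\<close>, while uniform distribution would force frequency \<open>b\<close> for
  the arc \<open>[0, b)\<close>.\<close>

lemma not_ud_mod1I:
  fixes x :: "nat \<Rightarrow> real"
  assumes m: "m > 0" and b: "0 < b" "b < 1 / real m"
    and freq: "\<exists>\<^sub>F i in sequentially. \<forall>j\<in>{fact i<..fact (Suc i)}. frac (x (m * j)) < b"
  shows "\<not> ud_mod1 x"
proof
  assume ud: "ud_mod1 x"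
  have m1: "1 / real m \<le> 1" using m by simp
  define F where "F = (\<lambda>N. 1 / real N * real (card {n \<in> {1..N}. frac (x n) \<in> {0..<b}}))"
  have "F \<longlonglongrightarrow> b - 0"
    unfolding F_def using ud[unfolded ud_mod1_def, rule_format, of 0 b] b m1 by linarith
  moreover have "filterlim (\<lambda>i. m * fact (Suc i)) at_top sequentially"
  proof (rule filterlim_at_top_mono[OF filterlim_ident always_eventually], intro allI)
    fix i show "i \<le> m * fact (Suc i)"
      using fact_ge_self[of "Suc i"] m by (metis Suc_leD le_trans mult_le_mono1 mult_1 Suc_leI One_nat_def)
  qed
  ultimately have "(\<lambda>i. F (m * fact (Suc i))) \<longlonglongrightarrow> b"
    using filterlim_compose by fastforce
  moreover have "(\<lambda>i. 1 / real m * (1 - 1 / real (Suc i))) \<longlonglongrightarrow> 1 / real m * (1 - 0)"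
    by (intro tendsto_intros LIMSEQ_Suc[OF lim_1_over_n])
  moreover obtain d where "b < d" "d < 1 / real m" using b(2) dense by blast
  ultimately have "\<forall>\<^sub>F i in sequentially. F (m * fact (Suc i)) < d"
    and "\<forall>\<^sub>F i in sequentially. d < 1 / real m * (1 - 1 / real (Suc i))"
    by (auto dest: order_tendstoD simp del: fact_Suc)
  then have "\<forall>\<^sub>F i in sequentially. F (m * fact (Suc i)) < 1 / real m * (1 - 1 / real (Suc i))"
    by eventually_elim (rule less_trans)
  \<comment> \<open>The hypothesis holds for infinitely many \<open>i\<close> and the upper bound on
    \<open>F\<close> for all large \<open>i\<close>, so some \<open>i\<close> satisfies
    both.\<close>
  from frequently_ex[OF frequently_eventually_frequently[OF freq this]]
  obtain i where *: "\<forall>j\<in>{fact i<..fact (Suc i)}. frac (x (m * j)) < b"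
    and less: "F (m * fact (Suc i)) < 1 / real m * (1 - 1 / real (Suc i))"
    by blast
  define N :: nat where "N = m * fact (Suc i)"
  have "(\<lambda>j. m * j) ` {fact i<..fact (Suc i)} \<subseteq> {n \<in> {1..N}. frac (x n) \<in> {0..<b}}"
    using * m by (auto simp: N_def Suc_le_eq)
  then have "card ((\<lambda>j. m * j) ` {fact i<..fact (Suc i)}) \<le> card {n \<in> {1..N}. frac (x n) \<in> {0..<b}}"
    by (intro card_mono) auto
  moreover have "card ((\<lambda>j. m * j) ` {fact i<..fact (Suc i)}) = (fact (Suc i) - fact i :: nat)"
    using m by (subst card_image) (auto simp: inj_on_def)
  ultimately have "real (fact (Suc i) - fact i) \<le> real (card {n \<in> {1..N}. frac (x n) \<in> {0..<b}})"
    by (metis of_nat_mono)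
  then have "1 / real N * real (fact (Suc i) - fact i) \<le> F N"
    unfolding F_def by (intro mult_left_mono) auto
  moreover have "real (fact (Suc i) - fact i) = real i * fact i"
    and "real N = real m * (real (Suc i) * fact i)"
    by (simp_all add: N_def distrib_right)
  moreover have "1 - 1 / real (Suc i) = real i / real (Suc i)"
    by (simp add: field_simps)
  ultimately have "1 / real m * (1 - 1 / real (Suc i)) \<le> F N"
    by (simp del: of_nat_Suc)
  then show False using less by (simp add: N_def)
qed

theorem theorem1p1:
  fixes \<alpha> :: real
  assumes "\<alpha> > 1"
  shows "(\<exists>C \<Xi> :: real set.
            uncountable C \<and> C \<subseteq> {0<..<1} - \<rat> \<and>
            \<Xi> \<subseteq> {0<..} \<and> \<Xi> \<approx> (UNIV :: nat set set) \<and>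
            (\<forall>\<xi>\<in>\<Xi>. C \<subseteq> spectrum (\<lambda>n. \<xi> * \<alpha> ^ n)) \<and>
            (\<forall>\<xi>\<in>\<Xi>. uncountable (spectrum (\<lambda>n. \<xi> * \<alpha> ^ n)))) \<and>
         \<not> (\<forall>\<xi> \<beta> :: real. \<xi> \<noteq> 0 \<longrightarrow> \<beta> > 1 \<longrightarrow> countable (spectrum (\<lambda>n. \<xi> * \<beta> ^ n)))"
proof -
  \<comment> \<open>The constant 1/6 gives \<open>L > 6 * m\<close>, which exceeds
    \<open>5 * m + 1\<close> since \<open>m > 1\<close>; hence \<open>5 * c < 1 / m\<close>
    below.\<close>
  have "(\<lambda>n. real n / \<alpha> ^ n) \<longlonglongrightarrow> 0"
    using powser_times_n_limit_0[of "inverse \<alpha>"] assms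
    by (simp add: field_simps inverse_less_1_iff)
  then have "\<forall>\<^sub>F n in sequentially. real n / \<alpha> ^ n < 1/6"
    by (rule order_tendstoD) simp
  moreover have "\<forall>\<^sub>F n::nat in sequentially. n > 1" by (rule eventually_gt_at_top)
  ultimately have "\<forall>\<^sub>F n in sequentially. n > 1 \<and> real n / \<alpha> ^ n < 1/6"
    by eventually_elim simp
  then obtain m where m: "m > 1" "real m / \<alpha> ^ m < 1/6"
    unfolding eventually_sequentially by blast
  define L where "L = \<alpha> ^ m"
  define c where "c = 1 / (L - 1)"
  have L6: "L > 6 * real m" using m(2) assms by (simp add: L_def field_simps)
  have L: "L > 5 * real m + 1" using L6 m(1) by linarith
  then have L1: "L > 1" by linarith
  have c0: "c > 0" using L1 by (simp add: c_def)
  have cm: "5 * c < 1 / real m" using L m(1) by (simp add: c_def field_simps)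
  have "1 / real m < 1" using m(1) by simp
  then have c1: "5 * c < 1" using cm by linarith
  have half: "1 / (2 * (L - 1)) = c / 2" by (simp add: c_def)

  obtain q :: "nat \<Rightarrow> real" where q: "\<And>J. closure (q ` {J..}) = UNIV"
    using exists_rational_sequence_dense_tails by blast
  \<comment> \<open>Multiplying an error below \<open>\<rho> i\<close> by any
    \<open>n \<le> m * fact (Suc i)\<close> costs at most \<open>c / 2\<close>.\<close>
  define \<rho> where "\<rho> = (\<lambda>i. c / (2 * real (m * fact (Suc i))))"
  define C where "C = {x \<in> {0<..<1} - \<rat>. \<exists>\<^sub>F i in sequentially. \<bar>x - q i\<bar> < \<rho> i}"
  have \<rho>: "\<rho> i > 0" for i using c0 m(1) by (simp add: \<rho>_def del: fact_Suc)
  have C: "uncountable C" unfolding C_def by (rule uncountable_irrational_limsup_balls[OF \<rho> q])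

  define idx where "idx = (\<lambda>j::nat. LEAST i. j \<le> fact (Suc i))"
  have idx: "idx j = i" if "fact i < j" "j \<le> fact (Suc i)" for i j
    unfolding idx_def
  proof (rule Least_equality)
    show "j \<le> fact (Suc i)" by (rule that(2))
  next
    fix k assume "j \<le> fact (Suc k)"
    then have "fact i < (fact (Suc k) :: nat)" using that(1) by linarith
    then show "i \<le> k" by (metis fact_mono_nat not_less not_less_eq_eq)
  qed

  \<comment> \<open>The offset \<open>c\<close> absorbs two errors of \<open>c / 2\<close>, one from
    the orbit and one from \<open>\<theta>\<close>, keeping values nonnegative. The bit has size
    \<open>2 * c\<close>, so values stay within \<open>4 * c\<close> and the bit survives two orbit
    errors.\<close>
  define T where "T = (\<lambda>B j. real (m * j) * q (idx j) + c + (if j \<in> B then 2 * c else 0))"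
  obtain X where X0: "\<And>B. X B > 0"
    and X: "\<And>B j. \<exists>k::int. \<bar>X B * L ^ j - T B j - of_int k\<bar> \<le> c / 2"
    using choice[OF allI[OF exists_geometric_orbit_near_targets[OF L1], of T]] unfolding half by blast

  \<comment> \<open>If \<open>A\<close> and \<open>B\<close> share a value of \<open>X\<close>,
    their targets agree up to \<open>c\<close> modulo one. They differ by at most
    \<open>2 * c\<close>, and \<open>3 * c < 1\<close> rules out a nonzero integer, so the bits
    coincide.\<close>
  have "inj X"
  proof (rule injI, rule set_eqI)
    fix A B j assume eq: "X A = X B"
    obtain k :: int where k: "\<bar>X A * L ^ j - T A j - of_int k\<bar> \<le> c / 2" using X by blast
    obtain l :: int where l: "\<bar>X A * L ^ j - T B j - of_int l\<bar> \<le> c / 2" using X eq by metis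
    have d: "\<bar>T A j - T B j + of_int (k - l)\<bar> \<le> c" using k l unfolding of_int_diff by linarith
    have "\<bar>T A j - T B j\<bar> \<le> 2 * c" using c0 by (simp add: T_def)
    then have "\<bar>of_int (k - l) :: real\<bar> < 1" using d c0 c1 by linarith
    then have "k - l = 0" by linarith
    then have "\<bar>T A j - T B j\<bar> \<le> c" using d by simp
    then show "j \<in> A \<longleftrightarrow> j \<in> B" using c0 by (auto simp: T_def split: if_splits)
  qed

  have sub: "C \<subseteq> spectrum (\<lambda>n. X B * \<alpha> ^ n)" for B
  proof
    fix \<theta> assume \<theta>: "\<theta> \<in> C"
    have "\<exists>\<^sub>F i in sequentially. \<bar>\<theta> - q i\<bar> < \<rho> i" using \<theta> by (simp add: C_def)
    then have "\<exists>\<^sub>F i in sequentially. \<forall>j\<in>{fact i<..fact (Suc i)}.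
                  frac (X B * \<alpha> ^ (m * j) - real (m * j) * \<theta>) < 5 * c"
    proof (rule frequently_elim1, intro ballI)
      fix i j :: nat assume i: "\<bar>\<theta> - q i\<bar> < \<rho> i" and j: "j \<in> {fact i<..fact (Suc i)}"
      obtain k :: int where k: "\<bar>X B * L ^ j - T B j - of_int k\<bar> \<le> c / 2" using X by blast
      have "real (m * j) * \<bar>\<theta> - q i\<bar> \<le> real (m * fact (Suc i)) * \<rho> i"
        using i j by (intro mult_mono of_nat_mono mult_le_mono2) auto
      also have "\<dots> = c / 2" using m(1) by (simp add: \<rho>_def del: fact_Suc)
      finally have "\<bar>real (m * j) * q i - real (m * j) * \<theta>\<bar> \<le> c / 2"
        by (simp add: abs_mult abs_minus_commute flip: right_diff_distrib)
      moreover have "real (m * j) * q i + c \<le> T B j" "T B j \<le> real (m * j) * q i + 3 * c"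
        using idx[of i j] j c0 by (simp_all add: T_def del: fact_Suc)
      moreover define v where "v = X B * L ^ j - real (m * j) * \<theta>"
      ultimately have v: "0 \<le> v - of_int k" "v - of_int k \<le> 4 * c"
        using k unfolding abs_le_iff by linarith+
      \<comment> \<open>As \<open>4 * c < 1\<close>, there is no wraparound; the strict bound
        \<open>5 * c\<close> then fits a half-open arc.\<close>
      then have "frac v = v - of_int k"
        using v c0 c1 by (subst frac_unique_iff) auto
      then show "frac (X B * \<alpha> ^ (m * j) - real (m * j) * \<theta>) < 5 * c"
        using v c0 by (simp add: v_def L_def power_mult)
    qed
    then have "\<not> ud_mod1 (\<lambda>n. X B * \<alpha> ^ n - real n * \<theta>)"
      using m(1) c0 cm by (intro not_ud_mod1I[where m = m and b = "5 * c"]) auto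
    then show "\<theta> \<in> spectrum (\<lambda>n. X B * \<alpha> ^ n)"
      using \<theta> by (simp add: C_def spectrum_def)
  qed
  then have unc: "uncountable (spectrum (\<lambda>n. X B * \<alpha> ^ n))" for B
    using C countable_subset by blast
  show ?thesis
  proof (rule conjI, rule exI[of _ C], rule exI[of _ "range X"], intro conjI)
    show "uncountable C" by (rule C)
    show "C \<subseteq> {0<..<1} - \<rat>" by (auto simp: C_def)
    show "range X \<subseteq> {0<..}" using X0 by auto
    show "range X \<approx> (UNIV :: nat set set)" using \<open>inj X\<close> by (rule inj_on_image_eqpoll_self)
    show "\<forall>\<xi>\<in>range X. C \<subseteq> spectrum (\<lambda>n. \<xi> * \<alpha> ^ n)" using sub by simp
    show "\<forall>\<xi>\<in>range X. uncountable (spectrum (\<lambda>n. \<xi> * \<alpha> ^ n))" using unc by simp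
    have "X {} \<noteq> 0" using X0[of "{}"] by simp
    then show "\<not> (\<forall>\<xi> \<beta> :: real. \<xi> \<noteq> 0 \<longrightarrow> \<beta> > 1 \<longrightarrow> countable (spectrum (\<lambda>n. \<xi> * \<beta> ^ n)))"
      using unc[of "{}"] assms by metis
  qed
qed

end
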